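(* Let $x(q) = \dfrac{(q;q^2)_\infty}{(q^3;q^6)_\infty^3}$. Then $$\frac{1}{x^2(q)} - 2q\,x(q) = 3q^2\,\frac{(q^2;q^2)_\infty^2 (q^{12};q^{12})_\infty^6}{(q^4;q^4)_\infty^2 (q^6;q^6)_\infty^6} + \frac{(q^4;q^4)_\infty^6}{(q^2;q^2)_\infty^2 (q^6;q^6)_\infty^2 (q^{12};q^{12})_\infty^2}.$$
   Context: Notation: $(a;q)_\infty=\prod_{n\ge1}(1-aq^{n-1})$; the identity is of formal power series in $q$ (equivalently for $|q|<1$). (Here $x(q)=q^{-1/3}v(q)$ where $v(q)$ is Ramanujan's cubic continued fraction.) *)

theory Defs
  imports "HOL-Analysis.Analysis"
begin

text \<open>
  The \<open>q\<close>-Pochhammer symbol \<open>(a;q)\<^sub>\<infinity> = \<Prod>n\<ge>1. 1 - a q\<^bsup>n-1\<^esup>\<close>, indexed here from \<open>0\<close>.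
  The product converges for all \<open>a\<close> when \<open>norm q < 1\<close>; for other \<open>q\<close> the value
  of \<^const>\<open>prodinf\<close> is not meaningful in general.
\<close>
definition qpochhammer_inf :: "complex \<Rightarrow> complex \<Rightarrow> complex" where
  "qpochhammer_inf a q = (\<Prod>n. 1 - a * q ^ n)"

text \<open>
  Here \<open>x(q) = q\<^bsup>-1/3\<^esup> v(q)\<close>, where \<open>v\<close> is Ramanujan's cubic continued fraction.
  For \<open>norm q < 1\<close> numerator and denominator are both nonzero.
\<close>
definition cubic_x :: "complex \<Rightarrow> complex" where
  "cubic_x q = qpochhammer_inf q (q ^ 2) / qpochhammer_inf (q ^ 3) (q ^ 6) ^ 3"

end

theory Submission
  imports Defs
begin

text \<open>
  Write \<open>E\<^sub>k = (q\<^sup>k;q\<^sup>k)\<^sub>\<infinity>\<close> and \<open>D = (q\<^sup>2;q\<^bsup>12\<^esup>)\<^sub>\<infinity> (q\<^bsup>10\<^esup>;q\<^bsup>12\<^esup>)\<^sub>\<infinity>\<close>. By Jacobi's triple product, a product of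
  two theta series in \<open>q\<^sup>3\<close>, split according to the parity of the sum of the summation indices, gives
  \<open>1/x(q) = (E\<^sub>4\<^sup>2 + q E\<^bsub>12\<^esub>\<^sup>2 D\<^sup>2) / (E\<^sub>6\<^sup>2 D)\<close>. The same dissection at \<open>-q\<close> gives
  \<open>x(q) = (E\<^sub>4\<^sup>2 - q E\<^bsub>12\<^esub>\<^sup>2 D\<^sup>2) E\<^bsub>12\<^esub>\<^sup>2 / E\<^sub>6\<^sup>4\<close>. In \<open>1/x\<^sup>2 - 2qx\<close> the odd parts cancel, and
  \<open>D = E\<^sub>2 E\<^bsub>12\<^esub> / (E\<^sub>4 E\<^sub>6)\<close> turns the even part into the right-hand side.
\<close>

section \<open>Infinite \<open>q\<close>-products: convergence, nonvanishing, splitting\<close>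

lemma convergent_prod_qpochhammer:
  fixes a q :: complex
  assumes "norm q < 1"
  shows "convergent_prod (\<lambda>n. 1 - a * q ^ n)"
proof -
  have "summable (\<lambda>n. norm a * norm q ^ n)"
    using assms by (intro summable_mult summable_geometric) auto
  then have "summable (\<lambda>n. norm ((1 - a * q ^ n) - 1))"
    by (simp add: norm_mult norm_power)
  then show ?thesis
    by (intro abs_convergent_prod_imp_convergent_prod summable_imp_abs_convergent_prod)
qed

lemma qpochhammer_inf_LIMSEQ:
  assumes "norm q < 1"
  shows "(\<lambda>n. \<Prod>k<n. 1 - a * q ^ k) \<longlonglongrightarrow> qpochhammer_inf a q"
  using convergent_prod_LIMSEQ[OF convergent_prod_qpochhammer[OF assms, of a]]
  by (subst (asm) LIMSEQ_lessThan_iff_atMost[symmetric]) (simp add: qpochhammer_inf_def)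

lemma qpochhammer_inf_nonzero:
  assumes "norm q < 1" "norm a < 1"
  shows "qpochhammer_inf a q \<noteq> 0"
  unfolding qpochhammer_inf_def
proof (rule prodinf_nonzero[OF convergent_prod_qpochhammer[OF assms(1)]])
  fix n
  have "norm (a * q ^ n) \<le> norm a * 1"
    unfolding norm_mult norm_power using assms by (intro mult_left_mono power_le_one) auto
  with assms(2) show "1 - a * q ^ n \<noteq> 0"
    by auto
qed

text \<open>Sort the factors by their exponent modulo \<open>k\<close>. The first
  \<open>n * k\<close> factors consist of \<open>n\<close> factors from each residue class, so
  comparing limits along the multiples of \<open>k\<close> suffices.\<close>

lemma qpochhammer_inf_split:
  assumes "norm q < 1" "k > 0"
  shows "qpochhammer_inf a q = (\<Prod>i<k. qpochhammer_inf (a * q ^ i) (q ^ k))"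
proof (rule LIMSEQ_unique)
  have qk: "norm (q ^ k) < 1"
    using assms by (simp add: norm_power power_less_one_iff)
  have "(\<Prod>j<n * k. 1 - a * q ^ j) = (\<Prod>i<k. \<Prod>j<n. 1 - a * q ^ i * (q ^ k) ^ j)" for n
  proof -
    have "(\<Prod>j<n * k. 1 - a * q ^ j) = (\<Prod>m<n. \<Prod>j = m * k..<m * k + k. 1 - a * q ^ j)"
      by (rule prod.nat_group[symmetric])
    also have "\<dots> = (\<Prod>m<n. \<Prod>i<k. 1 - a * q ^ i * (q ^ k) ^ m)"
    proof (rule prod.cong[OF refl])
      fix m
      have "(\<Prod>j = m * k..<m * k + k. 1 - a * q ^ j) = (\<Prod>i=0..<k. 1 - a * q ^ (i + m * k))"
        using prod.shift_bounds_nat_ivl[of "\<lambda>j. 1 - a * q ^ j" 0 "m * k" k]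
        by (simp add: add.commute)
      then show "(\<Prod>j = m * k..<m * k + k. 1 - a * q ^ j) = (\<Prod>i<k. 1 - a * q ^ i * (q ^ k) ^ m)"
        by (simp add: power_add mult.assoc atLeast0LessThan power_mult[symmetric] mult.commute[of k])
    qed
    finally show ?thesis
      by (subst prod.swap)
  qed
  moreover have "(\<lambda>n. \<Prod>i<k. \<Prod>j<n. 1 - a * q ^ i * (q ^ k) ^ j)
      \<longlonglongrightarrow> (\<Prod>i<k. qpochhammer_inf (a * q ^ i) (q ^ k))"
    by (intro tendsto_prod qpochhammer_inf_LIMSEQ qk)
  ultimately show "(\<lambda>n. \<Prod>j<n * k. 1 - a * q ^ j)
      \<longlonglongrightarrow> (\<Prod>i<k. qpochhammer_inf (a * q ^ i) (q ^ k))"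
    by simp
  have "filterlim (\<lambda>n. n * k) sequentially sequentially"
    using assms(2) by (simp add: mult_nat_right_at_top)
  then show "(\<lambda>n. \<Prod>j<n * k. 1 - a * q ^ j) \<longlonglongrightarrow> qpochhammer_inf a q"
    by (rule filterlim_compose[OF qpochhammer_inf_LIMSEQ[OF assms(1)]])
qed

lemma qpochhammer_inf_split_2:
  assumes "norm q < 1"
  shows "qpochhammer_inf a q = qpochhammer_inf a (q ^ 2) * qpochhammer_inf (a * q) (q ^ 2)"
  using qpochhammer_inf_split[OF assms, of 2 a] by (simp add: numeral_2_eq_2)

lemma qpochhammer_inf_split_3:
  assumes "norm q < 1"
  shows "qpochhammer_inf a q =
    qpochhammer_inf a (q ^ 3) * qpochhammer_inf (a * q) (q ^ 3) * qpochhammer_inf (a * q ^ 2) (q ^ 3)"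
  using qpochhammer_inf_split[OF assms, of 3 a] by (simp add: eval_nat_numeral)

lemma qpochhammer_inf_mult_minus:
  assumes "norm q < 1"
  shows "qpochhammer_inf a q * qpochhammer_inf (- a) q = qpochhammer_inf (a ^ 2) (q ^ 2)"
  unfolding qpochhammer_inf_def
  by (subst prodinf_mult[OF convergent_prod_qpochhammer convergent_prod_qpochhammer])
     (use assms in \<open>simp_all add: power2_eq_square power_mult_distrib algebra_simps\<close>)

section \<open>Theta series: absolute convergence and limits under the sum\<close>

definition theta :: "complex \<Rightarrow> complex \<Rightarrow> complex" where
  "theta z q = (\<Sum>\<^sub>\<infinity>n::int. q powi (n ^ 2) * z powi n)"

lemma summable_on_int:
  fixes f :: "int \<Rightarrow> real"
  assumes "(\<lambda>n::nat. f (int n)) summable_on UNIV" "(\<lambda>n::nat. f (- int n)) summable_on UNIV"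
  shows "f summable_on UNIV"
proof -
  have "f summable_on range int"
    using assms(1) by (subst summable_on_reindex) (auto simp: o_def)
  moreover have "f summable_on (\<lambda>n. - int n) ` {0<..}"
    using summable_on_subset_banach[OF assms(2), of "{0<..}"]
    by (subst summable_on_reindex) (auto simp: o_def inj_on_def)
  moreover have "range int \<inter> (\<lambda>n. - int n) ` {0<..} = {}"
    by auto
  ultimately have "f summable_on (range int \<union> (\<lambda>n. - int n) ` {0<..})"
    by (rule summable_on_Un_disjoint)
  moreover have "range int \<union> (\<lambda>n. - int n) ` {0<..} = UNIV"
  proof (intro equalityI subsetI UnCI)
    fix x :: int
    assume "x \<notin> (\<lambda>n. - int n) ` {0<..}"
    then show "x \<in> range int"
      by (cases x rule: int_cases2) (auto simp: image_iff)
  qed auto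
  ultimately show ?thesis
    by simp
qed

text \<open>A root test: the \<open>n\<close>-th term is the \<open>n\<close>-th power of
  \<open>r ^ n * w\<close>, which tends to 0, so a geometric series with ratio 1/2 eventually
  dominates for every \<open>w\<close>.\<close>

lemma summable_power_square:
  fixes r w :: real
  assumes "0 \<le> r" "r < 1" "0 \<le> w"
  shows "summable (\<lambda>n::nat. r ^ (n ^ 2) * w ^ n)"
proof (rule summable_comparison_test_ev)
  have "(\<lambda>n. r ^ n * w) \<longlonglongrightarrow> 0 * w"
    using assms by (intro tendsto_mult tendsto_const LIMSEQ_power_zero) auto
  then have "eventually (\<lambda>n. r ^ n * w < 1/2) sequentially"
    by (rule order_tendstoD) auto
  then show "eventually (\<lambda>n. norm (r ^ (n ^ 2) * w ^ n) \<le> (1/2) ^ n) sequentially"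
  proof eventually_elim
    case (elim n)
    have "r ^ (n ^ 2) * w ^ n = (r ^ n * w) ^ n"
      by (simp add: power_mult_distrib power2_eq_square power_mult)
    also have "\<dots> \<le> (1/2) ^ n"
      using elim assms by (intro power_mono) auto
    finally show ?case
      using assms by simp
  qed
qed (auto intro: summable_geometric)

lemma theta_abs_summable:
  fixes q z :: complex
  assumes "norm q < 1"
  shows "(\<lambda>n::int. norm (q powi (n ^ 2) * z powi n)) summable_on UNIV"
proof (rule summable_on_int)
  have *: "norm (q powi (int n ^ 2) * w ^ n) = norm q ^ (n ^ 2) * norm w ^ n" for w :: complex and n :: nat
    by (simp add: norm_mult norm_power flip: of_nat_power)
  have **: "(\<lambda>n. norm q ^ (n ^ 2) * norm w ^ n) summable_on UNIV" for w :: complex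
    by (intro norm_summable_imp_summable_on)
       (use summable_power_square[of "norm q" "norm w"] assms in simp)
  show "(\<lambda>n. norm (q powi (int n)\<^sup>2 * z powi int n)) summable_on UNIV"
    using **[of z] by (simp add: * )
  \<comment> \<open>The square ignores the sign of \<open>n\<close>, so the negative half is the
    positive half with \<open>inverse z\<close> in place of \<open>z\<close>.\<close>
  show "(\<lambda>n. norm (q powi (- int n)\<^sup>2 * z powi (- int n))) summable_on UNIV"
    using **[of "inverse z"] by (simp add: *[of _ "inverse z", symmetric] power_int_minus power_inverse)
qed

lemma theta_has_sum:
  assumes "norm q < 1"
  shows "((\<lambda>n::int. q powi (n ^ 2) * z powi n) has_sum theta z q) UNIV"
  unfolding theta_def
  by (rule has_sum_infsum, rule abs_summable_summable, rule theta_abs_summable[OF assms])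

text \<open>Tannery's theorem carried over to the integers: absolute summability permits summing in
  the order given by the enumeration \<open>int_decode\<close>.\<close>

lemma tendsto_infsum_int_dominated:
  fixes f :: "nat \<Rightarrow> int \<Rightarrow> complex"
  assumes lim: "\<And>j. (\<lambda>n. f n j) \<longlonglongrightarrow> g j"
    and bound: "\<And>n j. norm (f n j) \<le> M j"
    and M: "M summable_on UNIV"
  shows "(\<lambda>n. infsum (f n) UNIV) \<longlonglongrightarrow> infsum g UNIV"
proof -
  have inf: "infsum h UNIV = (\<Sum>k. h (int_decode k))"
    if "\<And>j. norm (h j) \<le> M j" for h :: "int \<Rightarrow> complex"
  proof -
    have "h summable_on UNIV"
      by (rule abs_summable_summable, rule Infinite_Sum.abs_summable_on_comparison_test'[OF M that])
    then have "(h has_sum infsum h UNIV) UNIV"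
      by simp
    then have "((\<lambda>k. h (int_decode k)) has_sum infsum h UNIV) UNIV"
      by (subst has_sum_reindex_bij_betw[OF bij_int_decode])
    then show ?thesis
      using has_sum_imp_sums sums_unique by blast
  qed
  \<comment> \<open>The bound survives the limit, so \<open>inf\<close> applies to \<open>g\<close>
    as well.\<close>
  have g: "norm (g j) \<le> M j" for j
    using tendsto_norm[OF lim[of j]] bound by (intro tendsto_upperbound) auto
  have "M summable_on UNIV \<longleftrightarrow> (\<lambda>k. M (int_decode k)) summable_on UNIV"
    by (rule summable_on_reindex_bij_betw[OF bij_int_decode, symmetric])
  then have sm: "summable (\<lambda>k. M (int_decode k))"
    using M summable_on_imp_summable by blast
  have bd: "eventually (\<lambda>(k, n). norm (f n (int_decode k)) \<le> M (int_decode k)) (at_top \<times>\<^sub>F sequentially)"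
    using bound by (intro always_eventually) auto
  have "(\<lambda>n. \<Sum>k. f n (int_decode k)) \<longlonglongrightarrow> (\<Sum>k. g (int_decode k))"
    using tannerys_theorem[where a = "\<lambda>k n. f n (int_decode k)" and F = sequentially, OF lim bd sm]
    by simp
  then show ?thesis
    by (simp add: inf[OF bound] inf[OF g])
qed

section \<open>The Jacobi triple product: finite form and limit\<close>

definition inv_qfact :: "complex \<Rightarrow> int \<Rightarrow> complex" where
  "inv_qfact Q k = (if k < 0 then 0 else 1 / (\<Prod>i<nat k. 1 - Q * Q ^ i))"

lemma one_minus_mult_power_nonzero:
  fixes Q :: complex
  assumes "norm Q < 1"
  shows "1 - Q * Q ^ i \<noteq> 0"
proof -
  have "norm (Q * Q ^ i) \<le> norm Q * 1"
    unfolding norm_mult norm_power using assms by (intro mult_left_mono power_le_one) auto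
  with assms show ?thesis
    by auto
qed

text \<open>The value 0 at negative integers makes the recurrence hold for every integer
  \<open>k\<close>: at \<open>k = 0\<close> the factor \<open>1 - Q powi 0\<close> vanishes. This
  removes boundary cases from the induction for the finite triple product.\<close>

lemma inv_qfact_pred:
  assumes "norm Q < 1"
  shows "inv_qfact Q (k - 1) = (1 - Q powi k) * inv_qfact Q k"
proof (cases "k \<le> 0")
  case True
  then show ?thesis
    by (cases "k = 0") (auto simp: inv_qfact_def)
next
  case False
  define m where "m = nat (k - 1)"
  have k: "k = int (Suc m)"
    using False by (simp add: m_def)
  have "inv_qfact Q (k - 1) = 1 / (\<Prod>i<m. 1 - Q * Q ^ i)"
    by (simp add: inv_qfact_def k)
  moreover have "inv_qfact Q k = 1 / ((\<Prod>i<m. 1 - Q * Q ^ i) * (1 - Q * Q ^ m))"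
    unfolding inv_qfact_def k nat_int by simp
  moreover have "Q powi k = Q * Q ^ m"
    unfolding k power_int_of_nat by simp
  ultimately show ?thesis
    using one_minus_mult_power_nonzero[OF assms, of m] by simp
qed

text \<open>The vanishing of \<^const>\<open>inv_qfact\<close> at negative integers encodes the summation range
  \<open>\<bar>j\<bar> \<le> n\<close>; the coefficients are Gaussian binomials.\<close>

lemma finite_jacobi_triple_product:
  assumes q: "norm q < 1" "q \<noteq> 0" and z: "z \<noteq> 0"
  shows "((\<lambda>j. (\<Prod>i<2 * n. 1 - q\<^sup>2 * (q\<^sup>2) ^ i) * inv_qfact (q\<^sup>2) (int n - j) * inv_qfact (q\<^sup>2) (int n + j)
             * (q powi (j ^ 2) * z powi j))
           has_sum (\<Prod>i<n. (1 + z * q * (q\<^sup>2) ^ i) * (1 + q / z * (q\<^sup>2) ^ i))) UNIV"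
proof (induction n)
  case 0
  show ?case
    by (rule has_sum_finite_neutralI[where B = "{0}"]) (auto simp: inv_qfact_def)
next
  case (Suc n)
  define Q where "Q = q\<^sup>2"
  have Q: "norm Q < 1" "Q \<noteq> 0"
    using q by (auto simp: Q_def norm_power power_less_one_iff)
  have sq: "Q powi k = q powi (2 * k)" for k
    by (simp add: Q_def power_int_mult)
  define a where "a = (\<lambda>n j. (\<Prod>i<2 * n. 1 - Q * Q ^ i) * inv_qfact Q (int n - j) * inv_qfact Q (int n + j)
             * (q powi (j ^ 2) * z powi j))"
  define P where "P = (\<Prod>i<n. (1 + z * q * Q ^ i) * (1 + q / z * Q ^ i))"
  \<comment> \<open>The two factors that enter at step \<open>n\<close> are \<open>1 + z * w\<close>
    and \<open>1 + w / z\<close>; their product is \<open>1 + w\<^sup>2 + w * z + w / z\<close>.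
    Multiplying the series by it therefore combines the coefficients at \<open>j\<close>,
    \<open>j - 1\<close> and \<open>j + 1\<close>.\<close>
  define w where "w = q * Q ^ n"
  have IH: "(a n has_sum P) UNIV"
    using Suc.IH by (simp add: a_def P_def Q_def)
  have m1: "((\<lambda>j. a n (j - 1)) has_sum P) UNIV"
    using IH by (subst has_sum_reindex_bij_witness[where j = "\<lambda>j. j - 1" and i = "\<lambda>j. j + 1" and T = UNIV and h = "a n"]) auto
  have p1: "((\<lambda>j. a n (j + 1)) has_sum P) UNIV"
    using IH by (subst has_sum_reindex_bij_witness[where j = "\<lambda>j. j + 1" and i = "\<lambda>j. j - 1" and T = UNIV and h = "a n"]) auto
  have "((\<lambda>j. (1 + w\<^sup>2) * a n j + w * z * a n (j - 1) + w / z * a n (j + 1))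
      has_sum ((1 + w\<^sup>2) * P + w * z * P + w / z * P)) UNIV"
    by (intro has_sum_add has_sum_cmult_right IH m1 p1)
  moreover have "(1 + w\<^sup>2) * P + w * z * P + w / z * P = P * ((1 + z * q * Q ^ n) * (1 + q / z * Q ^ n))"
    using z by (simp add: w_def field_simps power2_eq_square)
  moreover have "(1 + w\<^sup>2) * a n j + w * z * a n (j - 1) + w / z * a n (j + 1) = a (Suc n) j" for j
  proof -
    \<comment> \<open>All \<open>inv_qfact\<close> values are expressed through \<open>R\<close> and
      \<open>S\<close>, those of level \<open>n + 1\<close>, by applying the recurrence once or
      twice. The claim then becomes a polynomial identity in \<open>u\<close>, \<open>v\<close> and
      \<open>1 / Q\<close>.\<close>
    define u where "u = Q powi (int n + 1 - j)"
    define v where "v = Q powi (int n + 1 + j)"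
    define R where "R = inv_qfact Q (int n + 1 - j)"
    define S where "S = inv_qfact Q (int n + 1 + j)"
    define T where "T = (\<Prod>i<2 * n. 1 - Q * Q ^ i)"
    define c where "c = q powi (j ^ 2) * z powi j"
    have r1: "inv_qfact Q (int n - j) = (1 - u) * R" 
      using inv_qfact_pred[OF Q(1), of "int n + 1 - j"] by (simp add: u_def R_def algebra_simps)
    have r2: "inv_qfact Q (int n + j) = (1 - v) * S" 
      using inv_qfact_pred[OF Q(1), of "int n + 1 + j"] by (simp add: v_def S_def algebra_simps)
    have uQ: "Q powi (int n - j) = u / Q" and vQ: "Q powi (int n + j) = v / Q"
      using Q(2) by (simp_all add: u_def v_def power_int_diff power_int_add)
    have r3: "inv_qfact Q (int n - (j + 1)) = (1 - u / Q) * ((1 - u) * R)"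
      using inv_qfact_pred[OF Q(1), of "int n - j"] unfolding uQ r1 by (simp add: diff_diff_eq)
    have r4: "inv_qfact Q (int n + (j - 1)) = (1 - v / Q) * ((1 - v) * S)"
      using inv_qfact_pred[OF Q(1), of "int n + j"] unfolding vQ r2 by (simp add: add_diff_eq)
    \<comment> \<open>The shift of \<open>j\<close> is absorbed by comparing exponents of
      \<open>q\<close>, where \<open>w\<close> is \<open>q\<close> to the power
      \<open>2 * n + 1\<close>.\<close>
    have wu: "w * z * (q powi ((j - 1)^2) * z powi (j - 1)) = u * c"
    proof -
      have "w * q powi ((j - 1)^2) = q powi (1 + 2 * int n + (j - 1)^2)"
        using q by (simp add: w_def Q_def power_int_add power_int_mult power_mult)
      also have "1 + 2 * int n + (j - 1)^2 = 2 * (int n + 1 - j) + j ^ 2"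
        by (simp add: power2_eq_square algebra_simps)
      also have "q powi \<dots> = u * q powi (j ^ 2)"
        unfolding u_def sq using q by (subst power_int_add) auto
      finally show ?thesis
        using z by (simp add: c_def power_int_diff)
    qed
    have wv: "w / z * (q powi ((j + 1)^2) * z powi (j + 1)) = v * c"
    proof -
      have "w * q powi ((j + 1)^2) = q powi (1 + 2 * int n + (j + 1)^2)"
        using q by (simp add: w_def Q_def power_int_add power_int_mult power_mult)
      also have "1 + 2 * int n + (j + 1)^2 = 2 * (int n + 1 + j) + j ^ 2"
        by (simp add: power2_eq_square algebra_simps)
      also have "q powi \<dots> = v * q powi (j ^ 2)"
        unfolding v_def sq using q by (subst power_int_add) auto
      finally show ?thesis
        using z by (simp add: c_def power_int_add)
    qed
    have pow: "Q ^ (2 * n) = Q ^ n * Q ^ n"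
      by (simp add: mult_2 power_add)
    have uv: "Q * Q ^ (2 * n) = u * v / Q" "Q * (Q * Q ^ (2 * n)) = u * v"
      unfolding pow using Q by (simp_all add: u_def v_def power_int_diff power_int_add field_simps)
    have w2: "w\<^sup>2 = u * v / Q"
      using uv(1) by (simp add: w_def Q_def power_mult_distrib power_mult mult.commute)
    \<comment> \<open>The prefactor gains the factors for the indices \<open>2 * n\<close> and
      \<open>2 * n + 1\<close>, which are \<open>1 - u * v / Q\<close> and
      \<open>1 - u * v\<close>.\<close>
    have "a (Suc n) j = T * (1 - u * v / Q) * (1 - u * v) * R * S * c"
      by (simp add: a_def T_def R_def S_def c_def uv[symmetric] algebra_simps)
    moreover have "w * z * a n (j - 1) = u * c * T * R * ((1 - v / Q) * ((1 - v) * S))"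
    proof -
      have "w * z * a n (j - 1) = (w * z * (q powi ((j - 1)^2) * z powi (j - 1))) * T
          * inv_qfact Q (int n - (j - 1)) * inv_qfact Q (int n + (j - 1))"
        by (simp only: a_def T_def mult_ac)
      moreover have "inv_qfact Q (int n - (j - 1)) = R"
        by (simp add: R_def algebra_simps)
      ultimately show ?thesis
        by (simp only: wu r4)
    qed
    moreover have "w / z * a n (j + 1) = v * c * T * S * ((1 - u / Q) * ((1 - u) * R))"
    proof -
      have "w / z * a n (j + 1) = (w / z * (q powi ((j + 1)^2) * z powi (j + 1))) * T
          * inv_qfact Q (int n + (j + 1)) * inv_qfact Q (int n - (j + 1))"
        by (simp only: a_def T_def mult_ac)
      moreover have "inv_qfact Q (int n + (j + 1)) = S"
        by (simp add: S_def algebra_simps)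
      ultimately show ?thesis
        by (simp only: wv r3)
    qed
    moreover have "a n j = T * ((1 - u) * R) * ((1 - v) * S) * c"
      by (simp only: a_def T_def[symmetric] r1 r2 c_def)
    \<comment> \<open>Apart from the common factor \<open>T * R * S * c\<close>, what remains is (1
      + uv/Q)(1 - u)(1 - v) + u(1 - v/Q)(1 - v) + v(1 - u/Q)(1 - u) = (1 - uv/Q)(1 - uv).\<close>
    ultimately show ?thesis
      by (simp only: w2) (simp add: divide_inverse algebra_simps)
  qed
  ultimately show ?case
    by (simp add: a_def P_def Q_def)
qed

lemma inv_qfact_tendsto:
  assumes "norm Q < 1"
  shows "(\<lambda>n. inv_qfact Q (int n + j)) \<longlonglongrightarrow> 1 / qpochhammer_inf Q Q"
proof -
  have "(\<lambda>n. 1 / (\<Prod>i<n. 1 - Q * Q ^ i)) \<longlonglongrightarrow> 1 / qpochhammer_inf Q Q"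
    using assms by (intro tendsto_divide tendsto_const qpochhammer_inf_LIMSEQ qpochhammer_inf_nonzero)
  moreover have "filterlim (\<lambda>n. nat (int n + j)) sequentially sequentially"
    unfolding filterlim_at_top
  proof
    fix Z
    show "eventually (\<lambda>n. Z \<le> nat (int n + j)) sequentially"
      using eventually_ge_at_top[of "nat (int Z - j)"] by eventually_elim linarith
  qed
  ultimately have "(\<lambda>n. 1 / (\<Prod>i<nat (int n + j). 1 - Q * Q ^ i)) \<longlonglongrightarrow> 1 / qpochhammer_inf Q Q"
    by (rule filterlim_compose)
  moreover have "eventually (\<lambda>n. 1 / (\<Prod>i<nat (int n + j). 1 - Q * Q ^ i) = inv_qfact Q (int n + j)) sequentially"
    using eventually_ge_at_top[of "nat (- j)"]
    by eventually_elim (auto simp: inv_qfact_def)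
  ultimately show ?thesis
    by (rule Lim_transform_eventually)
qed

text \<open>Convergence bounds the values at nonnegative integers, and the others are 0. A bound
  uniform in the index is what domination in the limit of the finite triple product
  requires.\<close>

lemma inv_qfact_bounded:
  assumes "norm Q < 1"
  obtains B where "B > 0" "\<And>k. norm (inv_qfact Q k) \<le> B"
proof -
  have "Bseq (\<lambda>n. inv_qfact Q (int n + 0))"
    using inv_qfact_tendsto[OF assms] convergentI convergent_imp_Bseq by blast
  then obtain B where B: "B > 0" "\<And>n. norm (inv_qfact Q (int n)) \<le> B"
    unfolding Bseq_def by auto
  have "norm (inv_qfact Q k) \<le> B" for k
  proof (cases "k < 0")
    case True
    with B(1) show ?thesis
      by (simp add: inv_qfact_def)
  next
    case False
    with B(2)[of "nat k"] show ?thesis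
      by simp
  qed
  with B(1) that show thesis
    by blast
qed

text \<open>Let \<open>n\<close> tend to infinity in the finite form. Each Gaussian binomial tends
  to \<open>E * (1 / E) * (1 / E) = 1 / E\<close>, and all of them are bounded uniformly, so a
  multiple of the absolute theta series dominates.\<close>

theorem jacobi_triple_product:
  assumes q: "norm q < 1" "q \<noteq> 0" and z: "z \<noteq> 0"
  shows "theta z q =
    qpochhammer_inf (q\<^sup>2) (q\<^sup>2) * qpochhammer_inf (- (z * q)) (q\<^sup>2) * qpochhammer_inf (- (q / z)) (q\<^sup>2)"
proof -
  define Q where "Q = q\<^sup>2"
  have Q: "norm Q < 1"
    using q by (simp add: Q_def norm_power power_less_one_iff)
  define E where "E = qpochhammer_inf Q Q"
  have E: "E \<noteq> 0"
    unfolding E_def using Q by (intro qpochhammer_inf_nonzero)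
  define c where "c = (\<lambda>j. q powi (j ^ 2) * z powi j)"
  define A where "A = (\<lambda>n. \<Prod>i<2 * n. 1 - Q * Q ^ i)"
  define f where "f = (\<lambda>n j. A n * inv_qfact Q (int n - j) * inv_qfact Q (int n + j) * c j)"
  have A: "A \<longlonglongrightarrow> E"
    unfolding A_def E_def
    by (rule filterlim_compose[OF qpochhammer_inf_LIMSEQ[OF Q] mult_nat_left_at_top]) simp
  then have "Bseq A"
    using convergentI convergent_imp_Bseq by blast
  then obtain K where K: "K > 0" "\<And>n. norm (A n) \<le> K"
    unfolding Bseq_def by auto
  obtain B where B: "B > 0" "\<And>k. norm (inv_qfact Q k) \<le> B"
    using inv_qfact_bounded[OF Q] by blast
  have "(\<lambda>n. infsum (f n) UNIV) \<longlonglongrightarrow> infsum (\<lambda>j. c j / E) UNIV"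
  proof (rule tendsto_infsum_int_dominated)
    fix j
    have "(\<lambda>n. A n * inv_qfact Q (int n + - j) * inv_qfact Q (int n + j) * c j)
        \<longlonglongrightarrow> E * (1 / E) * (1 / E) * c j"
      unfolding E_def by (intro tendsto_mult inv_qfact_tendsto[OF Q] tendsto_const A[unfolded E_def])
    then show "(\<lambda>n. f n j) \<longlonglongrightarrow> c j / E"
      using E by (simp add: f_def)
  next
    fix n j
    show "norm (f n j) \<le> K * B * B * norm (c j)"
      unfolding f_def norm_mult using K B
      by (intro mult_mono mult_nonneg_nonneg) (auto intro: less_imp_le)
  next
    show "(\<lambda>j. K * B * B * norm (c j)) summable_on UNIV"
      unfolding c_def by (intro summable_on_cmult_right theta_abs_summable q)
  qed
  moreover have "infsum (f n) UNIV = (\<Prod>i<n. (1 + z * q * Q ^ i) * (1 + q / z * Q ^ i))" for n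
    using finite_jacobi_triple_product[OF q z, of n]
    by (intro infsumI) (simp add: f_def A_def c_def Q_def)
  moreover have "infsum (\<lambda>j. c j / E) UNIV = theta z q / E"
    using infsum_cmult_left'[of c "inverse E" UNIV] by (simp add: theta_def c_def divide_inverse)
  ultimately have "(\<lambda>n. \<Prod>i<n. (1 + z * q * Q ^ i) * (1 + q / z * Q ^ i)) \<longlonglongrightarrow> theta z q / E"
    by simp
  moreover have "(\<lambda>n. (\<Prod>i<n. 1 - (- (z * q)) * Q ^ i) * (\<Prod>i<n. 1 - (- (q / z)) * Q ^ i))
      \<longlonglongrightarrow> qpochhammer_inf (- (z * q)) Q * qpochhammer_inf (- (q / z)) Q"
    by (intro tendsto_mult qpochhammer_inf_LIMSEQ Q)
  ultimately have "theta z q / E = qpochhammer_inf (- (z * q)) Q * qpochhammer_inf (- (q / z)) Q"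
    by (intro LIMSEQ_unique) (simp_all add: prod.distrib)
  then show ?thesis
    using E by (simp add: E_def Q_def field_simps)
qed

section \<open>Products of two theta series and the 2-dissection\<close>

lemma has_sum_mult_Times:
  fixes f g :: "'a \<Rightarrow> complex"
  assumes "(\<lambda>x. norm (f x)) summable_on A" "(\<lambda>x. norm (g x)) summable_on B" "(f has_sum a) A" "(g has_sum b) B"
  shows "((\<lambda>(x, y). f x * g y) has_sum (a * b)) (A \<times> B)"
proof (rule has_sum_SigmaI)
  show "((\<lambda>y. case (x, y) of (x, y) \<Rightarrow> f x * g y) has_sum f x * b) B" for x
    using has_sum_cmult_right[OF assms(4)] by simp
  show "((\<lambda>x. f x * b) has_sum a * b) A"
    by (rule has_sum_cmult_left[OF assms(3)])
  have "(\<lambda>(x, y). norm (f x) * norm (g y)) summable_on A \<times> B"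
  proof (rule summable_on_SigmaI)
    show "((\<lambda>y. case (x, y) of (x, y) \<Rightarrow> norm (f x) * norm (g y))
        has_sum norm (f x) * infsum (\<lambda>y. norm (g y)) B) B" for x
      using has_sum_cmult_right[OF has_sum_infsum[OF assms(2)]] by simp
    show "(\<lambda>x. norm (f x) * infsum (\<lambda>y. norm (g y)) B) summable_on A"
      by (intro summable_on_cmult_left assms)
  qed auto
  then have "(\<lambda>p. norm (case p of (x, y) \<Rightarrow> f x * g y)) summable_on A \<times> B"
    by (simp add: case_prod_unfold norm_mult)
  then show "(\<lambda>(x, y). f x * g y) summable_on A \<times> B"
    by (rule abs_summable_summable)
qed

text \<open>Split the double series by the parity of \<open>m + n\<close>.\<close>

theorem theta_mult_theta:
  assumes q: "norm q < 1" "q \<noteq> 0" and "x \<noteq> 0" "y \<noteq> 0"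
  shows "theta x q * theta y q = theta (x * y) (q\<^sup>2) * theta (y / x) (q\<^sup>2)
    + q * y * (theta (q\<^sup>2 * x * y) (q\<^sup>2) * theta (q\<^sup>2 * y / x) (q\<^sup>2))"
proof -
  define F where "F = (\<lambda>(m :: int, n :: int). (q powi (m ^ 2) * x powi m) * (q powi (n ^ 2) * y powi n))"
  have double: "((\<lambda>(m :: int, n :: int). (r powi (m ^ 2) * u powi m) * (r powi (n ^ 2) * v powi n))
      has_sum theta u r * theta v r) UNIV" if "norm r < 1" for r u v
    using has_sum_mult_Times[OF theta_abs_summable theta_abs_summable theta_has_sum theta_has_sum,
        OF that that that that] by simp
  \<comment> \<open>\<open>g\<close> parametrizes the index pairs with even sum and \<open>h\<close>
    those with odd sum. In these coordinates the sum of the two squares has no mixed term, so the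
    double series factors again.\<close>
  define g h :: "int \<times> int \<Rightarrow> int \<times> int"
    where "g = (\<lambda>(a, b). (a - b, a + b))" and "h = (\<lambda>(a, b). (a - b, a + b + 1))"
  have inj: "inj g" "inj h"
    by (auto simp: g_def h_def inj_on_def)
  have q2: "norm (q\<^sup>2) < 1"
    using q by (simp add: norm_power power_less_one_iff)
  have sq: "(q\<^sup>2) powi k = q powi (2 * k)" for k
    by (simp add: power_int_mult)
  have "F (g (a, b)) = ((q\<^sup>2) powi (a ^ 2) * (x * y) powi a) * ((q\<^sup>2) powi (b ^ 2) * (y / x) powi b)" for a b
  proof -
    have *: "q powi ((a - b) ^ 2) * q powi ((a + b) ^ 2) = (q\<^sup>2) powi (a ^ 2) * (q\<^sup>2) powi (b ^ 2)"
    proof -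
      have "q powi ((a - b) ^ 2) * q powi ((a + b) ^ 2) = q powi ((a - b) ^ 2 + (a + b) ^ 2)"
        using q by (simp add: power_int_add)
      also have "(a - b) ^ 2 + (a + b) ^ 2 = 2 * a ^ 2 + 2 * b ^ 2"
        by (simp add: power2_eq_square algebra_simps)
      finally show ?thesis
        unfolding sq using q by (simp add: power_int_add)
    qed
    have **: "x powi (a - b) * y powi (a + b) = (x * y) powi a * (y / x) powi b"
      using assms by (simp add: power_int_diff power_int_add power_int_mult_distrib power_int_divide_distrib)
    have "F (g (a, b)) = (q powi ((a - b) ^ 2) * q powi ((a + b) ^ 2)) * (x powi (a - b) * y powi (a + b))"
      unfolding F_def g_def by simp
    also have "\<dots> = ((q\<^sup>2) powi (a ^ 2) * (x * y) powi a) * ((q\<^sup>2) powi (b ^ 2) * (y / x) powi b)"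
      unfolding * ** by (simp only: mult_ac)
    finally show ?thesis .
  qed
  then have "F \<circ> g = (\<lambda>(a, b). ((q\<^sup>2) powi (a ^ 2) * (x * y) powi a) * ((q\<^sup>2) powi (b ^ 2) * (y / x) powi b))"
    by (simp add: fun_eq_iff)
  then have "(F \<circ> g has_sum theta (x * y) (q\<^sup>2) * theta (y / x) (q\<^sup>2)) UNIV"
    using double[OF q2, of "x * y" "y / x"] by (simp only:)
  then have G: "(F has_sum theta (x * y) (q\<^sup>2) * theta (y / x) (q\<^sup>2)) (range g)"
    by (subst has_sum_reindex[OF inj(1)])
  have "F (h (a, b)) = q * y * (((q\<^sup>2) powi (a ^ 2) * (q\<^sup>2 * x * y) powi a)
      * ((q\<^sup>2) powi (b ^ 2) * (q\<^sup>2 * y / x) powi b))" for a b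
  proof -
    have "q powi ((a - b) ^ 2) * q powi ((a + b + 1) ^ 2)
        = q powi (1 + 2 * a ^ 2 + 2 * a + 2 * b ^ 2 + 2 * b)"
    proof -
      have "q powi ((a - b) ^ 2) * q powi ((a + b + 1) ^ 2) = q powi ((a - b) ^ 2 + (a + b + 1) ^ 2)"
        using q by (simp add: power_int_add)
      also have "(a - b) ^ 2 + (a + b + 1) ^ 2 = 1 + 2 * a ^ 2 + 2 * a + 2 * b ^ 2 + 2 * b"
        by (simp add: power2_eq_square algebra_simps)
      finally show ?thesis .
    qed
    \<comment> \<open>The linear terms \<open>2 * a\<close> and \<open>2 * b\<close> of the exponent
      put a factor \<open>q\<^sup>2\<close> into both theta arguments; the constant 1 leaves the
      factor \<open>q\<close> in front.\<close>
    also have "\<dots> = q * (q\<^sup>2) powi (a ^ 2) * (q\<^sup>2) powi a * (q\<^sup>2) powi (b ^ 2) * (q\<^sup>2) powi b"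
      unfolding sq using q by (simp add: power_int_add)
    finally have *: "q powi ((a - b) ^ 2) * q powi ((a + b + 1) ^ 2) = \<dots>" .
    have **: "x powi (a - b) * y powi (a + b + 1) = y * (x powi a * y powi a * (y powi b / x powi b))"
      using assms by (simp add: power_int_diff power_int_add)
    have "F (h (a, b)) = (q powi ((a - b) ^ 2) * q powi ((a + b + 1) ^ 2)) * (x powi (a - b) * y powi (a + b + 1))"
      unfolding F_def h_def by (simp add: add_ac)
    then show ?thesis
      unfolding * ** power_int_mult_distrib power_int_divide_distrib by (simp add: mult_ac)
  qed
  then have "F \<circ> h = (\<lambda>p. q * y * (case p of (a, b) \<Rightarrow> ((q\<^sup>2) powi (a ^ 2) * (q\<^sup>2 * x * y) powi a)
      * ((q\<^sup>2) powi (b ^ 2) * (q\<^sup>2 * y / x) powi b)))"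
    by (simp add: fun_eq_iff)
  then have "(F \<circ> h has_sum q * y * (theta (q\<^sup>2 * x * y) (q\<^sup>2) * theta (q\<^sup>2 * y / x) (q\<^sup>2))) UNIV"
    using has_sum_cmult_right[OF double[OF q2, of "q\<^sup>2 * x * y" "q\<^sup>2 * y / x"], of "q * y"]
    by (simp only:)
  then have H: "(F has_sum q * y * (theta (q\<^sup>2 * x * y) (q\<^sup>2) * theta (q\<^sup>2 * y / x) (q\<^sup>2))) (range h)"
    by (subst has_sum_reindex[OF inj(2)])
  have "range g \<inter> range h = {}"
  proof (rule equals0I)
    fix p
    assume "p \<in> range g \<inter> range h"
    then obtain u v where "p = g u" "p = h v"
      by blast
    moreover have "fst (g u) + snd (g u) = 2 * fst u" "fst (h v) + snd (h v) = 2 * fst v + 1"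
      by (simp_all add: g_def h_def case_prod_unfold)
    ultimately have "2 * fst u = 2 * fst v + 1"
      by simp
    then show False
      by presburger
  qed
  moreover have "range g \<union> range h = UNIV"
  proof (intro equalityI subsetI)
    fix p :: "int \<times> int"
    obtain m n where p: "p = (m, n)"
      by (cases p)
    show "p \<in> range g \<union> range h"
    proof (cases "even (m + n)")
      case True
      then obtain k where "m + n = 2 * k"
        by (elim evenE)
      \<comment> \<open>Solve \<open>a - b = m\<close> and \<open>a + b = n\<close>, which gives
        \<open>a = k\<close>, half the sum.\<close>
      then have "p = g (k, k - m)"
        by (simp add: p g_def)
      then show ?thesis by blast
    next
      case False
      then obtain k where "m + n = 2 * k + 1"
        by (elim oddE)
      then have "p = h (k, k - m)"
        by (simp add: p h_def)
      then show ?thesis by blast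
    qed
  qed auto
  ultimately have "(F has_sum theta (x * y) (q\<^sup>2) * theta (y / x) (q\<^sup>2)
    + q * y * (theta (q\<^sup>2 * x * y) (q\<^sup>2) * theta (q\<^sup>2 * y / x) (q\<^sup>2))) UNIV"
    using has_sum_Un_disjoint[OF G H] by simp
  moreover have "(F has_sum theta x q * theta y q) UNIV"
    unfolding F_def by (rule double[OF q(1)])
  ultimately show ?thesis
    by (rule has_sum_unique[symmetric])
qed

text \<open>The product form of \<open>theta (-1) (q\<^sup>3) * theta (q\<^sup>-\<^sup>2) (q\<^sup>3)\<close>; with \<open>q\<^sup>2\<close> in place of
  \<open>q\<^sup>-\<^sup>2\<close> the two factors of the odd part would no longer coincide.\<close>

lemma qpochhammer_inf_two_dissection:
  assumes q: "norm q < 1" "q \<noteq> 0"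
  shows "qpochhammer_inf (q ^ 6) (q ^ 6) ^ 2 * qpochhammer_inf (q ^ 3) (q ^ 6) ^ 2 *
      (qpochhammer_inf (- q) (q ^ 6) * qpochhammer_inf (- (q ^ 5)) (q ^ 6)) =
    qpochhammer_inf (q ^ 4) (q ^ 4) ^ 2 +
      q * qpochhammer_inf (q ^ 12) (q ^ 12) ^ 2 *
        (qpochhammer_inf (q ^ 2) (q ^ 12) * qpochhammer_inf (q ^ 10) (q ^ 12)) ^ 2"
proof -
  have small: "norm (q ^ k) < 1" if "k > 0" for k
    using q that by (simp add: norm_power power_less_one_iff)
  have pow: "(q ^ 3)\<^sup>2 = q ^ 6" "(q ^ 6)\<^sup>2 = q ^ 12"
    by (simp_all flip: power_mult)
  \<comment> \<open>With \<open>x = - 1\<close> the arguments \<open>x * y\<close> and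
    \<open>y / x\<close> agree, so both parts of the dissection are squares. The choice of
    \<open>y\<close> turns the coefficient \<open>q ^ 3 * y\<close> into \<open>q\<close>.\<close>
  have "theta (- 1) (q ^ 3) * theta (1 / q ^ 2) (q ^ 3) =
      theta (- (1 / q ^ 2)) (q ^ 6) ^ 2 + q * theta (- (q ^ 4)) (q ^ 6) ^ 2"
  proof -
    have "q ^ 6 * - 1 * (1 / q ^ 2) = - (q ^ 4)" "q ^ 6 * (1 / q ^ 2) / - 1 = - (q ^ 4)"
      "q ^ 3 * (1 / q ^ 2) = q"
      using q(2) by (simp_all add: divide_simps flip: power_add power_Suc)
    then show ?thesis
      using theta_mult_theta[of "q ^ 3" "- 1" "1 / q ^ 2"] q small[of 3]
      by (simp only: pow) (simp add: power2_eq_square)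
  qed
  moreover have "theta (- 1) (q ^ 3) = qpochhammer_inf (q ^ 6) (q ^ 6) * qpochhammer_inf (q ^ 3) (q ^ 6) ^ 2"
    using jacobi_triple_product[of "q ^ 3" "- 1"] q small[of 3]
    by (simp add: pow power2_eq_square)
  moreover have "theta (1 / q ^ 2) (q ^ 3) = qpochhammer_inf (q ^ 6) (q ^ 6) *
      (qpochhammer_inf (- q) (q ^ 6) * qpochhammer_inf (- (q ^ 5)) (q ^ 6))"
  proof -
    have "1 / q ^ 2 * q ^ 3 = q" "q ^ 3 / (1 / q ^ 2) = q ^ 5"
      using q(2) by (simp_all add: divide_simps flip: power_add power_Suc)
    then show ?thesis
      using jacobi_triple_product[of "q ^ 3" "1 / q ^ 2"] q small[of 3]
      by (simp only: pow) simp
  qed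
  moreover have "theta (- (1 / q ^ 2)) (q ^ 6) = qpochhammer_inf (q ^ 4) (q ^ 4)"
  proof -
    have "- (- (1 / q ^ 2) * q ^ 6) = q ^ 4" "- (q ^ 6 / - (1 / q ^ 2)) = q ^ 8"
      using q(2) by (simp_all add: divide_simps flip: power_add)
    \<comment> \<open>The multiples of 4 fall into the residues 0, 4 and 8 modulo 12.\<close>
    moreover have "qpochhammer_inf (q ^ 4) (q ^ 4) =
        qpochhammer_inf (q ^ 12) (q ^ 12) * qpochhammer_inf (q ^ 4) (q ^ 12) * qpochhammer_inf (q ^ 8) (q ^ 12)"
      using qpochhammer_inf_split_3[of "q ^ 4" "q ^ 4"] small[of 4]
      by (simp add: mult_ac flip: power_add power_mult)
    ultimately show ?thesis
      using jacobi_triple_product[of "q ^ 6" "- (1 / q ^ 2)"] q small[of 6]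
      by (simp only: pow) simp
  qed
  moreover have "theta (- (q ^ 4)) (q ^ 6) =
      qpochhammer_inf (q ^ 12) (q ^ 12) * (qpochhammer_inf (q ^ 2) (q ^ 12) * qpochhammer_inf (q ^ 10) (q ^ 12))"
  proof -
    have "- (- (q ^ 4) * q ^ 6) = q ^ 10" "- (q ^ 6 / - (q ^ 4)) = q ^ 2"
      using q(2) by (simp_all add: divide_simps flip: power_add)
    then show ?thesis
      using jacobi_triple_product[of "q ^ 6" "- (q ^ 4)"] q small[of 6]
      by (simp only: pow) simp
  qed
  ultimately show ?thesis
    by (simp add: power_mult_distrib power2_eq_square mult_ac)
qed

section \<open>The identity for \<open>cubic_x\<close>\<close>

theorem theorem2p2:
  fixes q :: complex
  assumes "norm q < 1"
  shows "1 / cubic_x q ^ 2 - 2 * q * cubic_x q =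
    3 * q ^ 2 *
      (qpochhammer_inf (q ^ 2) (q ^ 2) ^ 2 * qpochhammer_inf (q ^ 12) (q ^ 12) ^ 6) /
      (qpochhammer_inf (q ^ 4) (q ^ 4) ^ 2 * qpochhammer_inf (q ^ 6) (q ^ 6) ^ 6)
    + qpochhammer_inf (q ^ 4) (q ^ 4) ^ 6 /
      (qpochhammer_inf (q ^ 2) (q ^ 2) ^ 2 * qpochhammer_inf (q ^ 6) (q ^ 6) ^ 2 *
       qpochhammer_inf (q ^ 12) (q ^ 12) ^ 2)"
proof (cases "q = 0")
  \<comment> \<open>The dissection needs \<open>q \<noteq> 0\<close>; at \<open>q = 0\<close> both
    sides equal 1.\<close>
  case True
  then show ?thesis
    by (simp add: cubic_x_def qpochhammer_inf_def)
next
  case False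
  have small: "norm (q ^ k) < 1" if "k > 0" for k
    using assms that by (simp add: norm_power power_less_one_iff)
  have nz: "qpochhammer_inf (q ^ i) (q ^ k) \<noteq> 0" if "i > 0" "k > 0" for i k
    using that small by (intro qpochhammer_inf_nonzero)
  define a b c where "a = qpochhammer_inf q (q ^ 6)" and "b = qpochhammer_inf (q ^ 5) (q ^ 6)"
    and "c = qpochhammer_inf (q ^ 3) (q ^ 6)"
  \<comment> \<open>The primed products are the unprimed ones at \<open>- q\<close>. The quantities
    \<open>E2\<close>, \<open>E4\<close>, \<open>E6\<close>, \<open>E12\<close>, \<open>g\<close>
    and \<open>D\<close> involve even powers only and do not change under this sign.\<close>
  define a' b' c' where "a' = qpochhammer_inf (- q) (q ^ 6)" and "b' = qpochhammer_inf (- (q ^ 5)) (q ^ 6)"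
    and "c' = qpochhammer_inf (- (q ^ 3)) (q ^ 6)"
  define E2 E4 E6 E12 where "E2 = qpochhammer_inf (q ^ 2) (q ^ 2)" and "E4 = qpochhammer_inf (q ^ 4) (q ^ 4)"
    and "E6 = qpochhammer_inf (q ^ 6) (q ^ 6)" and "E12 = qpochhammer_inf (q ^ 12) (q ^ 12)"
  define g D where "g = qpochhammer_inf (q ^ 6) (q ^ 12)"
    and "D = qpochhammer_inf (q ^ 2) (q ^ 12) * qpochhammer_inf (q ^ 10) (q ^ 12)"
  have nonzero: "a \<noteq> 0" "b \<noteq> 0" "c \<noteq> 0" "E4 \<noteq> 0" "E6 \<noteq> 0" "E12 \<noteq> 0" "g \<noteq> 0" "D \<noteq> 0"
    using nz[of 1] nz by (auto simp: a_def b_def c_def E4_def E6_def E12_def g_def D_def)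
  have "qpochhammer_inf q (q ^ 2) = a * b * c"
    using qpochhammer_inf_split_3[of "q ^ 2" q] small[of 2]
    by (simp add: a_def b_def c_def mult_ac flip: power_add power_mult power_Suc)
  then have "cubic_x q = a * b * c / c ^ 3"
    by (simp add: cubic_x_def c_def)
  then have x: "cubic_x q = a * b / c ^ 2"
    using nonzero by (simp add: field_simps power2_eq_square power3_eq_cube)
  have D: "D = (a * b) * (a' * b')" and g: "g = c * c'"
    using qpochhammer_inf_mult_minus[of "q ^ 6" q] qpochhammer_inf_mult_minus[of "q ^ 6" "q ^ 5"]
      qpochhammer_inf_mult_minus[of "q ^ 6" "q ^ 3"] small[of 6]
    by (simp_all add: D_def g_def a_def b_def c_def a'_def b'_def c'_def mult_ac flip: power_mult)
  have E6: "E6 = g * E12"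
    using qpochhammer_inf_split_2[of "q ^ 6" "q ^ 6"] small[of 6]
    by (simp add: E6_def g_def E12_def flip: power_add power_mult)
  \<comment> \<open>The exponents congruent to 2 modulo 4 have the residues 2, 6 and 10 modulo
    12.\<close>
  have "qpochhammer_inf (q ^ 2) (q ^ 4) = D * g"
    using qpochhammer_inf_split_3[of "q ^ 4" "q ^ 2"] small[of 4]
    by (simp add: D_def g_def mult_ac flip: power_add power_mult)
  then have E2: "E2 = D * g * E4"
    using qpochhammer_inf_split_2[of "q ^ 2" "q ^ 2"] small[of 2]
    by (simp add: E2_def E4_def flip: power_add power_mult)
  define M N where "M = E4 ^ 2 + q * E12 ^ 2 * D ^ 2" and "N = E4 ^ 2 - q * E12 ^ 2 * D ^ 2"
  have M: "E6 ^ 2 * c ^ 2 * (a' * b') = M"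
    using qpochhammer_inf_two_dissection[of q] assms False
    by (simp add: M_def E4_def E6_def E12_def D_def c_def a'_def b'_def)
  have N: "E6 ^ 2 * c' ^ 2 * (a * b) = N"
    using qpochhammer_inf_two_dissection[of "- q"] assms False
    by (simp add: N_def E4_def E6_def E12_def D_def c'_def a_def b_def)
  \<comment> \<open>Since \<open>E6 = c * c' * E12\<close>, the quotient
    \<open>c' ^ 2 * E12 ^ 2 / E6 ^ 2\<close> is \<open>1 / c ^ 2\<close>.\<close>
  have x_N: "cubic_x q = N * E12 ^ 2 / E6 ^ 4"
    using nonzero unfolding x N[symmetric] E6 g by (simp add: field_simps)
  have x_M: "1 / cubic_x q = M / (E6 ^ 2 * D)"
    using nonzero unfolding x M[symmetric] D by (simp add: field_simps)
  have "1 / cubic_x q ^ 2 - 2 * q * cubic_x q = (1 / cubic_x q) ^ 2 - 2 * q * cubic_x q"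
    by (simp add: power_one_over)
  also have "\<dots> = (M / (E6 ^ 2 * D)) ^ 2 - 2 * q * (N * E12 ^ 2 / E6 ^ 4)"
    unfolding x_M by (simp only: x_N)
  also have "\<dots> = (M ^ 2 / D ^ 2 - 2 * q * N * E12 ^ 2) / E6 ^ 4"
    by (simp add: power_divide power_mult_distrib diff_divide_distrib mult_ac flip: power_mult)
  \<comment> \<open>The cross term of \<open>M ^ 2\<close> cancels against the \<open>E4 ^ 2\<close>
    part of \<open>N\<close>. The coefficient 3 is 1 from \<open>M ^ 2\<close> plus 2 from the other
    part of \<open>N\<close>.\<close>
  also have "M ^ 2 / D ^ 2 - 2 * q * N * E12 ^ 2 = 3 * q ^ 2 * E12 ^ 4 * D ^ 2 + E4 ^ 4 / D ^ 2"
    using nonzero by (simp add: M_def N_def field_simps) algebra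
  also have "\<dots> / E6 ^ 4 = 3 * q ^ 2 * (E2 ^ 2 * E12 ^ 6) / (E4 ^ 2 * E6 ^ 6)
      + E4 ^ 6 / (E2 ^ 2 * E6 ^ 2 * E12 ^ 2)"
  proof -
    \<comment> \<open>The factorizations of \<open>E2\<close> and \<open>E6\<close> amount to
      \<open>D = E2 * E12 / (E4 * E6)\<close>, which eliminates \<open>D\<close>.\<close>
    have "3 * q ^ 2 * E12 ^ 4 * D ^ 2 / E6 ^ 4 = 3 * q ^ 2 * (E2 ^ 2 * E12 ^ 6) / (E4 ^ 2 * E6 ^ 6)"
      using nonzero unfolding E2 E6 by (simp add: divide_simps)
    moreover have "E4 ^ 4 / D ^ 2 / E6 ^ 4 = E4 ^ 6 / (E2 ^ 2 * E6 ^ 2 * E12 ^ 2)"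
      using nonzero unfolding E2 E6 by (simp add: divide_simps) algebra
    ultimately show ?thesis
      by (simp add: add_divide_distrib)
  qed
  finally show ?thesis
    by (simp only: E2_def E4_def E6_def E12_def)
qed

end
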